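(* Let $\lambda\in(0,1)$ and let $Q=(\lambda^{|i-j|})_{i,j=1}^n\in\mathbb{R}^{n\times n}$ be the one-dimensional Wasserstein-1 metric matrix. Then $$1=\omega(I)=\omega(QQ^{-1})\le \|QQ^{-1}\|_2\le \|Q\|_2\|Q^{-1}\|_2=\kappa_2(Q)\le 2\,\omega(Q)\,\|Q^{-1}\|_2\le \frac{2(1+\lambda)^2(1-\lambda^{n-1})}{(1-\lambda)^2}<\frac{2(1+\lambda)^2}{(1-\lambda)^2}.$$
   Context: Here $\lambda=e^{-h/\varepsilon}$ with $h,\varepsilon>0$, so $\lambda\in(0,1)$; $Q$ is known to be symmetric positive definite, hence invertible. $I$ is the $n\times n$ identity matrix, $\|\cdot\|_2$ is the spectral norm, $\kappa_2(A)=\|A\|_2\|A^{-1}\|_2$ is the corresponding condition number, and $\omega(A)=\max\{|x^*Ax|: x\in\mathbb{C}^n,\ \|x\|_2=1\}$ is the numerical radius.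
   Formalization: The bound of 2ω(Q)‖Q⁻¹‖ by 2(1+λ)²(1−λ^{n−1})/(1−λ)² is stated only for n ≥ 2, since for n = 1 it would read 2 ≤ 0; all other links, and the strict bound of 2ω(Q)‖Q⁻¹‖ by 2(1+λ)²/(1−λ)², hold for every n ≥ 1. *)

theory Defs
  imports "HOL-Analysis.Analysis"
begin

(* Rows and columns of an n x n matrix are indexed by a finite type; idx numbers the
   elements of that type by 1, ..., n (in the theorem it is a bijection onto {1..n}). *)
definition wasserstein_mat :: "('n::finite \<Rightarrow> nat) \<Rightarrow> real \<Rightarrow> real^'n^'n" where
  "wasserstein_mat idx lam = (\<chi> i j. lam ^ nat \<bar>int (idx i) - int (idx j)\<bar>)"

(* The norm of real^'n is the Euclidean one, so its operator norm is the spectral norm. *)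
definition spectral_norm :: "real^'n^'n \<Rightarrow> real" where
  "spectral_norm A = onorm (\<lambda>x. A *v x)"

definition cond_number :: "real^'n^'n \<Rightarrow> real" where
  "cond_number A = spectral_norm A * spectral_norm (matrix_inv A)"

definition complex_mat :: "real^'n^'n \<Rightarrow> complex^'n^'n" where
  "complex_mat A = (\<chi> i j. complex_of_real (A $ i $ j))"

(* The sum is x^* A x.  The inner product of complex^'n in the library is real-valued (the real
   part of the Hermitian product), so it cannot be used here.  The supremum is attained, see
   numerical_radius_attained below. *)
definition numerical_radius :: "complex^'n^'n \<Rightarrow> real" where
  "numerical_radius A =
     Sup {cmod (\<Sum>i\<in>UNIV. cnj (x $ i) * (A *v x) $ i) | x. norm x = 1}"

lemma numerical_radius_attained:
  fixes A :: "complex^'n^'n"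
  defines "S \<equiv> {cmod (\<Sum>i\<in>UNIV. cnj (x $ i) * (A *v x) $ i) | x. norm x = 1}"
  shows "numerical_radius A \<in> S" and "\<And>y. y \<in> S \<Longrightarrow> y \<le> numerical_radius A"
proof -
  define f where "f = (\<lambda>x. cmod (\<Sum>i\<in>UNIV. cnj (x $ i) * (A *v x) $ i))"
  have S: "S = f ` sphere 0 1"
    by (auto simp: S_def f_def)
  have "continuous_on (sphere 0 1) f"
    unfolding f_def matrix_vector_mult_def by (auto intro!: continuous_intros)
  then have comp: "compact S"
    unfolding S by (intro compact_continuous_image compact_sphere)
  have "sphere (0 :: complex^'n) 1 \<noteq> {}"
    by simp
  then have ne: "S \<noteq> {}"
    unfolding S by blast
  have bdd: "bdd_above S"
    using comp by (simp add: bounded_imp_bdd_above compact_imp_bounded)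
  have nr: "numerical_radius A = Sup S"
    by (simp add: numerical_radius_def S_def)
  show "numerical_radius A \<in> S"
    unfolding nr by (rule closed_contains_Sup[OF ne bdd compact_imp_closed[OF comp]])
  show "y \<le> numerical_radius A" if "y \<in> S" for y
    unfolding nr by (rule cSup_upper[OF that bdd])
qed

end

theory Submission
  imports Defs
begin

text \<open>The inverse of \<open>Q\<close> is tridiagonal. The Schur test bounds \<open>\<parallel>Q\<^sup>-\<^sup>1\<parallel>\<close> by its largest
  absolute row sum \<open>(1 + \<lambda>)\<^sup>2 / (1 - \<lambda>\<^sup>2)\<close>, and bounds \<open>\<omega>(Q) \<le> \<parallel>Q\<parallel>\<close> by the largest row sum of \<open>Q\<close>;
  the \<open>k\<close>-th row sum is \<open>(1 + \<lambda> - \<lambda>\<^sup>k - \<lambda>\<^bsup>n+1-k\<^esup>) / (1 - \<lambda>)\<close>.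
  As \<open>Q\<close> is symmetric, polarization gives even \<open>\<parallel>Q\<parallel> \<le> \<omega>(Q)\<close>.\<close>

section \<open>Spectral norm: basic properties and the Schur test\<close>

lemma norm_mult_vec_le_spectral_norm: "norm (A *v x) \<le> spectral_norm A * norm x"
  unfolding spectral_norm_def by (rule onorm) (rule matrix_vector_mul_bounded_linear)

lemma spectral_norm_nonneg: "0 \<le> spectral_norm A"
  unfolding spectral_norm_def by (rule onorm_pos_le) (rule matrix_vector_mul_bounded_linear)

lemma spectral_norm_mult_le: "spectral_norm (A ** B) \<le> spectral_norm A * spectral_norm B"
  using onorm_compose[OF matrix_vector_mul_bounded_linear[of A] matrix_vector_mul_bounded_linear[of B]]
  by (simp add: spectral_norm_def o_def matrix_vector_mul_assoc)

text \<open>Taking for \<open>y\<close> the vector \<open>A *v x\<close> rescaled to the norm of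
  \<open>x\<close> turns the hypothesis into
  \<open>norm x * norm (A *v x) \<le> r * (norm x)^2\<close>. The arithmetic mean of the squared
  norms is the form that both the Schur test and polarization produce.\<close>

lemma spectral_norm_le_bilinear:
  fixes A :: "real^'n^'n"
  assumes "\<And>x y. y \<bullet> (A *v x) \<le> r * (((norm x)\<^sup>2 + (norm y)\<^sup>2) / 2)"
  shows "spectral_norm A \<le> r"
  unfolding spectral_norm_def
proof (rule onorm_le)
  fix x :: "real^'n"
  show "norm (A *v x) \<le> r * norm x"
  proof (cases "A *v x = 0")
    case True
    \<comment> \<open>The zero vector against any unit vector gives \<open>0 \<le> r / 2\<close>;
      the choice of the index is immaterial.\<close>
    have "0 \<le> r"
      using assms[of 0 "axis undefined 1"] by (simp add: norm_axis_1)
    then show ?thesis using True by simp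
  next
    case False
    then have x: "norm x > 0" by auto
    define a where "a = norm (A *v x)"
    have a: "a > 0" using False by (simp add: a_def)
    have "(norm x / a) *\<^sub>R (A *v x) \<bullet> (A *v x) = norm x * a"
      using a by (simp add: dot_square_norm a_def power2_eq_square)
    moreover have "norm ((norm x / a) *\<^sub>R (A *v x)) = norm x"
      using a by (simp add: a_def)
    ultimately have "norm x * a \<le> r * (norm x)\<^sup>2"
      using assms[of "(norm x / a) *\<^sub>R (A *v x)" x] by simp
    then have "norm x * a \<le> norm x * (r * norm x)"
      by (simp add: power2_eq_square algebra_simps)
    then show ?thesis using x by (simp add: a_def)
  qed
qed

text \<open>Schur test: after the arithmetic-geometric mean inequality is applied to each entry, the
  squares of \<open>x\<close> collect the column sums and the squares of \<open>y\<close> the row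
  sums.\<close>

lemma spectral_norm_le_schur:
  fixes A :: "real^'n^'n"
  assumes row: "\<And>i. (\<Sum>j\<in>UNIV. \<bar>A $ i $ j\<bar>) \<le> r"
    and col: "\<And>j. (\<Sum>i\<in>UNIV. \<bar>A $ i $ j\<bar>) \<le> r"
  shows "spectral_norm A \<le> r"
proof (rule spectral_norm_le_bilinear)
  fix x y :: "real^'n"
  have norm2: "(norm z)\<^sup>2 = (\<Sum>i\<in>UNIV. (z $ i)\<^sup>2)" for z :: "real^'n"
    by (simp add: norm_vec_def L2_set_def sum_nonneg)
  have summand: "y $ i * (A $ i $ j * x $ j) \<le> \<bar>A $ i $ j\<bar> * (((x $ j)\<^sup>2 + (y $ i)\<^sup>2) / 2)" for i j
  proof -
    have "\<bar>x $ j * y $ i\<bar> \<le> ((x $ j)\<^sup>2 + (y $ i)\<^sup>2) / 2"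
      using sum_squares_bound[of "\<bar>x $ j\<bar>" "\<bar>y $ i\<bar>"] by (simp add: abs_mult)
    then have "\<bar>A $ i $ j\<bar> * \<bar>x $ j * y $ i\<bar> \<le> \<bar>A $ i $ j\<bar> * (((x $ j)\<^sup>2 + (y $ i)\<^sup>2) / 2)"
      by (rule mult_left_mono) simp
    moreover have "y $ i * (A $ i $ j * x $ j) \<le> \<bar>A $ i $ j\<bar> * \<bar>x $ j * y $ i\<bar>"
      using abs_ge_self[of "A $ i $ j * (x $ j * y $ i)"] by (simp add: abs_mult mult_ac)
    ultimately show ?thesis by linarith
  qed
  have "y \<bullet> (A *v x) = (\<Sum>i\<in>UNIV. \<Sum>j\<in>UNIV. y $ i * (A $ i $ j * x $ j))"
    by (simp add: inner_vec_def matrix_vector_mult_def sum_distrib_left)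
  also have "\<dots> \<le> (\<Sum>i\<in>UNIV. \<Sum>j\<in>UNIV. \<bar>A $ i $ j\<bar> * (((x $ j)\<^sup>2 + (y $ i)\<^sup>2) / 2))"
    by (intro sum_mono summand)
  also have "\<dots> = (\<Sum>i\<in>UNIV. \<Sum>j\<in>UNIV. \<bar>A $ i $ j\<bar> * ((x $ j)\<^sup>2 / 2))
      + (\<Sum>i\<in>UNIV. \<Sum>j\<in>UNIV. \<bar>A $ i $ j\<bar> * ((y $ i)\<^sup>2 / 2))"
    by (simp add: sum.distrib[symmetric] add_divide_distrib distrib_left)
  also have "(\<Sum>i\<in>UNIV. \<Sum>j\<in>UNIV. \<bar>A $ i $ j\<bar> * ((x $ j)\<^sup>2 / 2))
      = (\<Sum>j\<in>UNIV. (\<Sum>i\<in>UNIV. \<bar>A $ i $ j\<bar>) * ((x $ j)\<^sup>2 / 2))"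
    unfolding sum_distrib_right by (rule sum.swap)
  also have "\<dots> \<le> (\<Sum>j\<in>UNIV. r * ((x $ j)\<^sup>2 / 2))"
    by (intro sum_mono mult_right_mono col) simp
  also have "(\<Sum>i\<in>UNIV. \<Sum>j\<in>UNIV. \<bar>A $ i $ j\<bar> * ((y $ i)\<^sup>2 / 2))
      = (\<Sum>i\<in>UNIV. (\<Sum>j\<in>UNIV. \<bar>A $ i $ j\<bar>) * ((y $ i)\<^sup>2 / 2))"
    by (simp only: sum_distrib_right)
  also have "\<dots> \<le> (\<Sum>i\<in>UNIV. r * ((y $ i)\<^sup>2 / 2))"
    by (intro sum_mono mult_right_mono row) simp
  finally show "y \<bullet> (A *v x) \<le> r * (((norm x)\<^sup>2 + (norm y)\<^sup>2) / 2)"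
    by (simp add: norm2 sum_distrib_left[symmetric] sum_divide_distrib[symmetric]
        distrib_left add_divide_distrib)
qed

section \<open>Numerical radius and its comparison with the spectral norm\<close>

lemma cmod_quadratic_form_le_numerical_radius:
  assumes "norm x = 1"
  shows "cmod (\<Sum>i\<in>UNIV. cnj (x $ i) * (A *v x) $ i) \<le> numerical_radius A"
  using assms by (intro numerical_radius_attained(2)) blast

lemma numerical_radius_nonneg: "0 \<le> numerical_radius A"
  using numerical_radius_attained(1)[of A] by auto

text \<open>A real matrix acts separately on the real and imaginary parts of a vector, and the
  squared norms of these parts add up. Hence passing to complex vectors does not increase the
  operator norm.\<close>

lemma norm_complex_mat_mult_vec_le:
  fixes A :: "real^'n^'n" and x :: "complex^'n"
  shows "norm (complex_mat A *v x) \<le> spectral_norm A * norm x"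
proof -
  define u v :: "real^'n" where "u = (\<chi> i. Re (x $ i))" and "v = (\<chi> i. Im (x $ i))"
  have split: "(norm z)\<^sup>2 = (norm (\<chi> i. Re (z $ i) :: real^'n))\<^sup>2 + (norm (\<chi> i. Im (z $ i) :: real^'n))\<^sup>2"
    for z :: "complex^'n"
    by (simp add: norm_vec_def L2_set_def sum_nonneg cmod_power2 sum.distrib)
  have "(\<chi> i. Re ((complex_mat A *v x) $ i)) = A *v u" "(\<chi> i. Im ((complex_mat A *v x) $ i)) = A *v v"
    by (simp_all add: vec_eq_iff matrix_vector_mult_def complex_mat_def u_def v_def)
  then have "(norm (complex_mat A *v x))\<^sup>2 = (norm (A *v u))\<^sup>2 + (norm (A *v v))\<^sup>2"
    by (subst split) simp
  also have "\<dots> \<le> (spectral_norm A * norm u)\<^sup>2 + (spectral_norm A * norm v)\<^sup>2"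
    by (intro add_mono power_mono norm_mult_vec_le_spectral_norm) simp_all
  also have "\<dots> = (spectral_norm A * norm x)\<^sup>2"
    using split[of x] by (simp add: power_mult_distrib distrib_left u_def v_def)
  finally show ?thesis
    by (rule power2_le_imp_le) (simp add: spectral_norm_nonneg)
qed

text \<open>Cauchy-Schwarz at a unit vector where the maximum is attained.\<close>

lemma numerical_radius_le_spectral_norm: "numerical_radius (complex_mat A) \<le> spectral_norm A"
proof -
  obtain x where x: "norm x = 1"
    and eq: "numerical_radius (complex_mat A) = cmod (\<Sum>i\<in>UNIV. cnj (x $ i) * (complex_mat A *v x) $ i)"
    using numerical_radius_attained(1)[of "complex_mat A"] by auto
  have "cmod (\<Sum>i\<in>UNIV. cnj (x $ i) * (complex_mat A *v x) $ i)
      \<le> (\<Sum>i\<in>UNIV. cmod (x $ i) * cmod ((complex_mat A *v x) $ i))"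
    by (rule order_trans[OF norm_sum]) (simp add: norm_mult)
  also have "\<dots> \<le> norm x * norm (complex_mat A *v x)"
    unfolding norm_vec_def
    using L2_set_mult_ineq[of "\<lambda>i. cmod (x $ i)" "\<lambda>i. cmod ((complex_mat A *v x) $ i)" UNIV] by simp
  also have "\<dots> \<le> spectral_norm A"
    using norm_complex_mat_mult_vec_le[of A x] by (simp add: x)
  finally show ?thesis by (simp add: eq)
qed

lemma numerical_radius_one: "numerical_radius (complex_mat (mat 1 :: real^'n^'n)) = 1"
proof -
  have one: "complex_mat (mat 1 :: real^'n^'n) = mat 1"
    by (simp add: complex_mat_def mat_def vec_eq_iff)
  have "(\<Sum>i\<in>UNIV. cnj (x $ i) * x $ i) = complex_of_real ((norm x)\<^sup>2)" for x :: "complex^'n"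
    by (simp add: norm_vec_def L2_set_def sum_nonneg complex_norm_square[symmetric] mult.commute
        flip: of_real_power)
  then show ?thesis
    using numerical_radius_attained(1)[of "mat 1 :: complex^'n^'n"] by (auto simp: one)
qed

lemma abs_quadratic_form_le_numerical_radius:
  fixes A :: "real^'n^'n" and x :: "real^'n"
  shows "\<bar>x \<bullet> (A *v x)\<bar> \<le> numerical_radius (complex_mat A) * (norm x)\<^sup>2"
proof (cases "x = 0")
  case False
  define z where "z = x /\<^sub>R norm x"
  define w :: "complex^'n" where "w = (\<chi> i. of_real (z $ i))"
  have "norm z = 1" using False by (simp add: z_def)
  then have "norm w = 1" by (simp add: w_def norm_vec_def)
  then have "cmod (\<Sum>i\<in>UNIV. cnj (w $ i) * (complex_mat A *v w) $ i) \<le> numerical_radius (complex_mat A)"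
    by (rule cmod_quadratic_form_le_numerical_radius)
  moreover have "(\<Sum>i\<in>UNIV. cnj (w $ i) * (complex_mat A *v w) $ i) = of_real (z \<bullet> (A *v z))"
    by (simp add: w_def matrix_vector_mult_def complex_mat_def inner_vec_def)
  ultimately have le: "\<bar>z \<bullet> (A *v z)\<bar> \<le> numerical_radius (complex_mat A)"
    by simp
  have "x = norm x *\<^sub>R z" using False by (simp add: z_def)
  then have "x \<bullet> (A *v x) = (norm x *\<^sub>R z) \<bullet> (A *v (norm x *\<^sub>R z))" by simp
  also have "\<dots> = (norm x)\<^sup>2 * (z \<bullet> (A *v z))"
    by (simp add: matrix_vector_mult_scaleR power2_eq_square)
  finally have "\<bar>x \<bullet> (A *v x)\<bar> = (norm x)\<^sup>2 * \<bar>z \<bullet> (A *v z)\<bar>"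
    by (simp add: abs_mult)
  then show ?thesis
    using mult_left_mono[OF le, of "(norm x)\<^sup>2"] by (simp add: mult.commute)
qed simp

text \<open>Polarization: symmetry makes the two cross terms agree, so the bilinear form is a
  difference of two values of the quadratic form, and the parallelogram law sums their
  bounds.\<close>

lemma spectral_norm_le_numerical_radius_if_symmetric:
  fixes A :: "real^'n^'n"
  assumes "transpose A = A"
  shows "spectral_norm A \<le> numerical_radius (complex_mat A)"
proof (rule spectral_norm_le_bilinear)
  fix x y :: "real^'n"
  let ?w = "numerical_radius (complex_mat A)"
  have sym: "x \<bullet> (A *v y) = y \<bullet> (A *v x)"
    using dot_lmul_matrix[of x A y] assms by (metis inner_commute transpose_matrix_vector)
  have "4 * (y \<bullet> (A *v x)) = (x + y) \<bullet> (A *v (x + y)) - (x - y) \<bullet> (A *v (x - y))"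
    by (simp add: matrix_vector_right_distrib matrix_vector_mult_diff_distrib inner_add_left
        inner_add_right inner_diff_left inner_diff_right sym)
  also have "\<dots> \<le> ?w * (norm (x + y))\<^sup>2 + ?w * (norm (x - y))\<^sup>2"
    using abs_quadratic_form_le_numerical_radius[of "x + y" A]
      abs_quadratic_form_le_numerical_radius[of "x - y" A] by linarith
  also have "\<dots> = ?w * (2 * (norm x)\<^sup>2 + 2 * (norm y)\<^sup>2)"
    by (simp add: power2_norm_eq_inner inner_add_left inner_add_right inner_diff_left
        inner_diff_right inner_commute algebra_simps)
  finally show "y \<bullet> (A *v x) \<le> ?w * (((norm x)\<^sup>2 + (norm y)\<^sup>2) / 2)"
    by (simp add: field_simps)
qed

section \<open>Row sums and spectral norm of the Wasserstein matrix\<close>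

text \<open>Induction from \<open>n = k\<close>, where the sum is a geometric series. Each further
  index \<open>Suc m\<close> adds \<open>(1 - lam) * lam ^ (Suc m - k)\<close>, which raises the
  exponent of the last term by one.\<close>

lemma sum_power_dist:
  fixes lam :: real
  assumes "1 \<le> k" "k \<le> n"
  shows "(1 - lam) * (\<Sum>j=1..n. lam ^ nat \<bar>int k - int j\<bar>) = 1 + lam - lam ^ k - lam ^ (n + 1 - k)"
  using assms(2)
proof (induction n rule: dec_induct)
  case base
  have "(\<Sum>j=1..k. lam ^ nat \<bar>int k - int j\<bar>) = (\<Sum>i<k. lam ^ i)"
    by (rule sum.reindex_bij_witness[of _ "\<lambda>i. k - i" "\<lambda>j. k - j"])
      (auto simp: nat_diff_distrib intro!: arg_cong2[where f = power])
  then show ?case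
    using one_diff_power_eq[of lam k] by simp
next
  case (step m)
  have "nat \<bar>int k - int (Suc m)\<bar> = Suc m - k" "Suc m + 1 - k = Suc (Suc m - k)"
    using step.hyps by auto
  with step.IH show ?case
    using step.hyps by (simp add: algebra_simps)
qed

lemma sum_UNIV_reindex:
  assumes "bij_betw idx UNIV {1..n::nat}"
  shows "(\<Sum>i\<in>UNIV. f (idx i)) = (\<Sum>k=1..n. f k)"
  using sum.reindex_bij_betw[OF assms] .

lemma transpose_wasserstein_mat: "transpose (wasserstein_mat idx lam) = wasserstein_mat idx lam"
  by (simp add: wasserstein_mat_def transpose_def vec_eq_iff abs_minus_commute)

text \<open>By symmetry the column sums are the row sums, so the Schur test applies. The bound
  \<open>r\<close> is left free because the row sums are later estimated in two different
  ways.\<close>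

lemma spectral_norm_wasserstein_mat_le:
  fixes idx :: "'n::finite \<Rightarrow> nat"
  assumes lam: "0 < lam" "lam < 1" and idx: "bij_betw idx UNIV {1..n}"
    and r: "\<And>k. 1 \<le> k \<Longrightarrow> k \<le> n \<Longrightarrow> (1 + lam - lam ^ k - lam ^ (n + 1 - k)) / (1 - lam) \<le> r"
  shows "spectral_norm (wasserstein_mat idx lam) \<le> r"
proof -
  have row: "(\<Sum>j\<in>UNIV. lam ^ nat \<bar>int (idx i) - int (idx j)\<bar>) \<le> r" for i
  proof -
    have i: "1 \<le> idx i" "idx i \<le> n" using bij_betwE[OF idx] by auto
    have "(\<Sum>k=1..n. lam ^ nat \<bar>int (idx i) - int k\<bar>)
        = (1 + lam - lam ^ idx i - lam ^ (n + 1 - idx i)) / (1 - lam)"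
      using sum_power_dist[OF i, of lam] lam by (simp add: eq_divide_eq mult.commute)
    then show ?thesis
      using r[OF i] sum_UNIV_reindex[OF idx, of "\<lambda>k. lam ^ nat \<bar>int (idx i) - int k\<bar>"] by simp
  qed
  show ?thesis
    using lam row by (intro spectral_norm_le_schur) (simp_all add: wasserstein_mat_def abs_minus_commute)
qed

section \<open>The tridiagonal inverse and its norm\<close>

text \<open>Indices run over \<open>1..n\<close>, so for \<open>k = 1\<close> the condition \<open>j = k - 1\<close> never holds. For \<open>n = 1\<close>
  both corrections of the diagonal apply, which gives the entry \<open>1\<close>.\<close>

definition wasserstein_inv_entry :: "nat \<Rightarrow> real \<Rightarrow> nat \<Rightarrow> nat \<Rightarrow> real" where
  "wasserstein_inv_entry n lam k j =
    ((if j = k then 1 + lam\<^sup>2 - (if k = 1 then lam\<^sup>2 else 0) - (if k = n then lam\<^sup>2 else 0) else 0)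
      - (if j = k + 1 then lam else 0) - (if j = k - 1 then lam else 0)) / (1 - lam\<^sup>2)"

lemma wasserstein_inv_entry_commute:
  "1 \<le> k \<Longrightarrow> 1 \<le> j \<Longrightarrow> wasserstein_inv_entry n lam k j = wasserstein_inv_entry n lam j k"
  by (auto simp: wasserstein_inv_entry_def)

lemma sum_abs_wasserstein_inv_entry_le:
  assumes lam: "0 < lam" "lam < 1" and k: "1 \<le> k" "k \<le> n"
  shows "(\<Sum>j=1..n. \<bar>wasserstein_inv_entry n lam k j\<bar>) \<le> (1 + lam) / (1 - lam)"
proof -
  have pos: "1 - lam\<^sup>2 > 0" using lam by (simp add: power_less_one_iff abs_square_less_1)
  \<comment> \<open>\<open>?b\<close> omits the corner corrections and counts the off-diagonal terms
    positively, so \<open>?b j / (1 - lam^2)\<close> dominates the absolute value of the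
    entry.\<close>
  let ?b = "\<lambda>j. (if j = k then 1 + lam\<^sup>2 else 0) + (if j = k + 1 then lam else 0)
      + (if j = k - 1 then lam else 0)"
  have "(\<Sum>j=1..n. \<bar>wasserstein_inv_entry n lam k j\<bar>) \<le> (\<Sum>j=1..n. ?b j / (1 - lam\<^sup>2))"
    using pos lam
    by (intro sum_mono) (auto simp: wasserstein_inv_entry_def abs_le_iff intro!: divide_right_mono)
  also have "\<dots> \<le> (1 + lam\<^sup>2 + lam + lam) / (1 - lam\<^sup>2)"
    unfolding sum_divide_distrib[symmetric]
    using pos lam by (intro divide_right_mono) (auto simp: sum.distrib)
  also have "\<dots> = ((1 + lam) * (1 + lam)) / ((1 - lam) * (1 + lam))"
    by (simp add: power2_eq_square algebra_simps)
  also have "\<dots> = (1 + lam) / (1 - lam)" using lam by simp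
  finally show ?thesis .
qed

text \<open>A column of \<open>Q\<close> is geometric on either side of \<open>m\<close>. For an
  interior \<open>k\<close> other than \<open>m\<close>, the neighbours satisfy
  \<open>lam * (f (k + 1) + f (k - 1)) = (1 + lam^2) * f k\<close>, so the row cancels; at
  \<open>k = m\<close> both neighbours are \<open>lam\<close>, leaving \<open>1 - lam^2\<close>. At
  a corner, the missing neighbour would contribute \<open>lam^2 * f k\<close>, which is exactly the
  correction of the diagonal.\<close>

lemma sum_wasserstein_inv_entry_mult:
  assumes lam: "0 < lam" "lam < 1" and k: "1 \<le> k" "k \<le> n" and m: "1 \<le> m" "m \<le> n"
  shows "(\<Sum>j=1..n. wasserstein_inv_entry n lam k j * lam ^ nat \<bar>int j - int m\<bar>) = (if k = m then 1 else 0)"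
proof -
  have pos: "1 - lam\<^sup>2 > 0" using lam by (simp add: power_less_one_iff abs_square_less_1)
  define f where "f j = lam ^ nat \<bar>int j - int m\<bar>" for j
  define c where "c = 1 + lam\<^sup>2 - (if k = 1 then lam\<^sup>2 else 0) - (if k = n then lam\<^sup>2 else 0)"
  have "wasserstein_inv_entry n lam k j * f j = ((if j = k then c * f j else 0)
      - (if j = k + 1 then lam * f j else 0) - (if j = k - 1 then lam * f j else 0)) / (1 - lam\<^sup>2)" for j
    by (simp add: wasserstein_inv_entry_def c_def left_diff_distrib diff_divide_distrib)
  moreover have "k \<in> {1..n}" "k + 1 \<in> {1..n} \<longleftrightarrow> k < n" "k - 1 \<in> {1..n} \<longleftrightarrow> 1 < k"
    using k by auto
  ultimately have sum: "(\<Sum>j=1..n. wasserstein_inv_entry n lam k j * f j)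
      = (c * f k - (if k < n then lam * f (k + 1) else 0) - (if 1 < k then lam * f (k - 1) else 0))
        / (1 - lam\<^sup>2)"
    by (simp only: sum_divide_distrib[symmetric] sum_subtractf sum.delta finite_atLeastAtMost if_True)
  \<comment> \<open>A step towards \<open>m\<close> divides \<open>f\<close> by \<open>lam\<close>,
    a step away multiplies it by \<open>lam\<close>.\<close>
  have right: "f (k + 1) = (if k < m then f k / lam else lam * f k)"
  proof -
    have "nat \<bar>int k - int m\<bar> = Suc (nat \<bar>int (k + 1) - int m\<bar>)" if "k < m"
      using that by auto
    moreover have "nat \<bar>int (k + 1) - int m\<bar> = Suc (nat \<bar>int k - int m\<bar>)" if "\<not> k < m"
      using that by auto
    ultimately show ?thesis using lam by (simp add: f_def)
  qed
  \<comment> \<open>Since \<open>1 \<le> k\<close>, the subtraction \<open>k - 1\<close> is not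
    truncated.\<close>
  have left: "f (k - 1) = (if m < k then f k / lam else lam * f k)"
  proof -
    have "nat \<bar>int k - int m\<bar> = Suc (nat \<bar>int (k - 1) - int m\<bar>)" if "m < k"
      using that by auto
    moreover have "nat \<bar>int (k - 1) - int m\<bar> = Suc (nat \<bar>int k - int m\<bar>)" if "\<not> m < k"
      using that k by auto
    ultimately show ?thesis using lam by (simp add: f_def)
  qed
  have "c * f k - (if k < n then lam * f (k + 1) else 0) - (if 1 < k then lam * f (k - 1) else 0)
      = (if k = m then 1 - lam\<^sup>2 else 0)"
  proof -
    have "f k = 1" if "k = m" using that by (simp add: f_def)
    then show ?thesis
      unfolding right left c_def using lam k m
      by (auto simp: power2_eq_square algebra_simps simp del: One_nat_def)
  qed
  then show ?thesis
    using sum pos by (simp add: f_def)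
qed

text \<open>A left inverse of a square matrix is two-sided. This existence gives
  \<open>matrix_inv\<close>, defined by choice, its inverse property, and uniqueness identifies it
  with the explicit matrix.\<close>

lemma wasserstein_mat_inverse:
  fixes idx :: "'n::finite \<Rightarrow> nat"
  assumes lam: "0 < lam" "lam < 1" and idx: "bij_betw idx UNIV {1..n}"
  defines "Q \<equiv> wasserstein_mat idx lam"
  shows "Q ** matrix_inv Q = mat 1" and "matrix_inv Q = (\<chi> i j. wasserstein_inv_entry n lam (idx i) (idx j))"
proof -
  define P :: "real^'n^'n" where "P = (\<chi> i j. wasserstein_inv_entry n lam (idx i) (idx j))"
  have "1 \<le> idx i" "idx i \<le> n" for i using bij_betwE[OF idx] by auto
  moreover have "idx i = idx j \<longleftrightarrow> i = j" for i j
    using bij_betw_imp_inj_on[OF idx] by (simp add: inj_eq)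
  ultimately have "(P ** Q) $ i $ j = (if i = j then 1 else 0)" for i j
    using sum_UNIV_reindex[OF idx,
        of "\<lambda>k. wasserstein_inv_entry n lam (idx i) k * lam ^ nat \<bar>int k - int (idx j)\<bar>"]
      sum_wasserstein_inv_entry_mult[OF lam, of "idx i" n "idx j"]
    by (simp add: matrix_matrix_mult_def P_def Q_def wasserstein_mat_def)
  then have PQ: "P ** Q = mat 1"
    by (simp add: vec_eq_iff mat_def)
  then have QP: "Q ** P = mat 1"
    by (simp add: matrix_left_right_inverse)
  have "\<exists>A'. Q ** A' = mat 1 \<and> A' ** Q = mat 1" using PQ QP by blast
  then show "Q ** matrix_inv Q = mat 1" 
    unfolding matrix_inv_def by (rule someI2_ex) blast
  then have "matrix_inv Q = P"
    using PQ by (metis matrix_mul_assoc matrix_mul_lid matrix_mul_rid)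
  then show "matrix_inv Q = (\<chi> i j. wasserstein_inv_entry n lam (idx i) (idx j))"
    by (simp add: P_def)
qed

lemma spectral_norm_matrix_inv_wasserstein_mat_le:
  fixes idx :: "'n::finite \<Rightarrow> nat"
  assumes lam: "0 < lam" "lam < 1" and idx: "bij_betw idx UNIV {1..n}"
  shows "spectral_norm (matrix_inv (wasserstein_mat idx lam)) \<le> (1 + lam) / (1 - lam)"
proof -
  have i: "1 \<le> idx i" "idx i \<le> n" for i using bij_betwE[OF idx] by auto
  have row: "(\<Sum>j\<in>UNIV. \<bar>wasserstein_inv_entry n lam (idx i) (idx j)\<bar>) \<le> (1 + lam) / (1 - lam)" for i
    using sum_UNIV_reindex[OF idx, of "\<lambda>k. \<bar>wasserstein_inv_entry n lam (idx i) k\<bar>"]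
      sum_abs_wasserstein_inv_entry_le[OF lam i] by simp
  show ?thesis
    unfolding wasserstein_mat_inverse(2)[OF assms]
    using row wasserstein_inv_entry_commute[OF i(1) i(1)]
    by (intro spectral_norm_le_schur) simp_all
qed

section \<open>The chain of inequalities for the condition number\<close>

(* The bound 2(1+lam)^2(1-lam^(n-1))/(1-lam)^2 is 0 for n = 1, where cond_number Q = 1, so the inequality
   leading to it needs n >= 2.  The last conjunct is what remains of the chain for n = 1; for n >= 2
   it follows from the two before it. *)
theorem mainTheorem3:
  fixes lam :: real and n :: nat and idx :: "'n::finite \<Rightarrow> nat" and Q :: "real^'n^'n"
  assumes "0 < lam" and "lam < 1"
    and "bij_betw idx UNIV {1..n}"
    and "Q = wasserstein_mat idx lam"
  shows "1 = numerical_radius (complex_mat (mat 1 :: real^'n^'n))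
    \<and> numerical_radius (complex_mat (mat 1 :: real^'n^'n))
        = numerical_radius (complex_mat (Q ** matrix_inv Q))
    \<and> numerical_radius (complex_mat (Q ** matrix_inv Q)) \<le> spectral_norm (Q ** matrix_inv Q)
    \<and> spectral_norm (Q ** matrix_inv Q) \<le> spectral_norm Q * spectral_norm (matrix_inv Q)
    \<and> spectral_norm Q * spectral_norm (matrix_inv Q) = cond_number Q
    \<and> cond_number Q \<le> 2 * numerical_radius (complex_mat Q) * spectral_norm (matrix_inv Q)
    \<and> (2 \<le> n \<longrightarrow> 2 * numerical_radius (complex_mat Q) * spectral_norm (matrix_inv Q)
          \<le> 2 * (1 + lam)\<^sup>2 * (1 - lam ^ (n - 1)) / (1 - lam)\<^sup>2)
    \<and> 2 * (1 + lam)\<^sup>2 * (1 - lam ^ (n - 1)) / (1 - lam)\<^sup>2 < 2 * (1 + lam)\<^sup>2 / (1 - lam)\<^sup>2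
    \<and> 2 * numerical_radius (complex_mat Q) * spectral_norm (matrix_inv Q)
        < 2 * (1 + lam)\<^sup>2 / (1 - lam)\<^sup>2"
proof -
  let ?w = "numerical_radius (complex_mat Q)" and ?s = "spectral_norm (matrix_inv Q)"
  note lam = assms(1,2)
  have inv: "Q ** matrix_inv Q = mat 1"
    using wasserstein_mat_inverse(1)[OF assms(1-3)] assms(4) by simp
  have s: "0 \<le> ?s" "?s \<le> (1 + lam) / (1 - lam)"
    using spectral_norm_matrix_inv_wasserstein_mat_le[OF assms(1-3)] assms(4)
    by (simp_all add: spectral_norm_nonneg)
  have w_le: "?w \<le> r / (1 - lam)" if "\<And>k. 1 \<le> k \<Longrightarrow> k \<le> n \<Longrightarrow> 1 + lam - lam ^ k - lam ^ (n + 1 - k) \<le> r" for r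
    using numerical_radius_le_spectral_norm[of Q] spectral_norm_wasserstein_mat_le[OF assms(1-3), of "r / (1 - lam)"]
      that lam assms(4) by (simp add: divide_right_mono)
  \<comment> \<open>Here \<open>a\<close> measures the gain over the crude bound
    \<open>(1 + lam) / (1 - lam)\<close> for \<open>?w\<close>; it is chosen in two ways
    below.\<close>
  have prod_le: "2 * ?w * ?s \<le> 2 * (1 + lam) * a * (1 + lam) / (1 - lam)\<^sup>2"
    if "?w \<le> (1 + lam) * a / (1 - lam)" for a
  proof -
    have "?w * ?s \<le> (1 + lam) * a / (1 - lam) * ((1 + lam) / (1 - lam))"
      using that s numerical_radius_nonneg[of "complex_mat Q"] by (intro mult_mono) auto
    then have "2 * (?w * ?s) \<le> 2 * ((1 + lam) * a / (1 - lam) * ((1 + lam) / (1 - lam)))" by simp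
    then show ?thesis by (simp add: power2_eq_square mult.assoc del: distrib_left_numeral)
  qed
  have cond: "cond_number Q \<le> 2 * ?w * ?s"
  proof -
    have "spectral_norm Q \<le> ?w"
      using transpose_wasserstein_mat assms(4)
      by (intro spectral_norm_le_numerical_radius_if_symmetric) simp
    then have "spectral_norm Q \<le> 2 * ?w"
      using numerical_radius_nonneg[of "complex_mat Q"] by linarith
    then show ?thesis
      unfolding cond_number_def using s(1) by (rule mult_right_mono)
  qed
  have upper: "2 * ?w * ?s \<le> 2 * (1 + lam)\<^sup>2 * (1 - lam ^ (n - 1)) / (1 - lam)\<^sup>2" if n: "2 \<le> n"
  proof -
    have "?w \<le> (1 + lam) * (1 - lam ^ (n - 1)) / (1 - lam)"
    proof (rule w_le)
      fix k assume k: "1 \<le> k" "k \<le> n"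
      \<comment> \<open>For \<open>k < n\<close> the exponents satisfy \<open>k \<le> n - 1\<close>
        and \<open>n + 1 - k \<le> n\<close>. For \<open>k = n\<close> they are \<open>n\<close> and
        \<open>1\<close>, and \<open>1 \<le> n - 1\<close> is where \<open>2 \<le> n\<close> enters.
        The left side equals \<open>(1 + lam) * lam ^ (n - 1)\<close>.\<close>
      have "lam ^ (n - 1) + lam ^ n \<le> lam ^ k + lam ^ (n + 1 - k)"
      proof (cases "k = n")
        case True
        then show ?thesis using lam n power_decreasing[of 1 "n - 1" lam] by simp
      next
        case False
        then show ?thesis using lam k by (intro add_mono power_decreasing) auto
      qed
      moreover have "lam ^ n = lam * lam ^ (n - 1)"
        using n by (simp flip: power_Suc)
      ultimately show "1 + lam - lam ^ k - lam ^ (n + 1 - k) \<le> (1 + lam) * (1 - lam ^ (n - 1))"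
        by (simp add: algebra_simps)
    qed
    from prod_le[OF this] show ?thesis by (simp add: power2_eq_square mult_ac)
  qed
  have last: "2 * ?w * ?s < 2 * (1 + lam)\<^sup>2 / (1 - lam)\<^sup>2"
  proof -
    \<comment> \<open>Chosen so that \<open>(1 + lam) * a = 1 + lam - lam ^ n\<close>, which bounds
      every row sum numerator for each \<open>n\<close>, including \<open>n = 1\<close>;
      \<open>a < 1\<close> makes the final inequality strict.\<close>
    define a where "a = 1 - lam ^ n / (1 + lam)"
    have "?w \<le> (1 + lam) * a / (1 - lam)"
    proof (rule w_le)
      fix k assume k: "1 \<le> k" "k \<le> n"
      have "lam ^ n \<le> lam ^ k" "0 < lam ^ (n + 1 - k)"
        using lam k by (auto intro: power_decreasing)
      moreover have "(1 + lam) * a = 1 + lam - lam ^ n"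
        using lam by (simp add: a_def right_diff_distrib)
      ultimately show "1 + lam - lam ^ k - lam ^ (n + 1 - k) \<le> (1 + lam) * a"
        by linarith
    qed
    from prod_le[OF this] have "2 * ?w * ?s \<le> 2 * (1 + lam)\<^sup>2 / (1 - lam)\<^sup>2 * a"
      by (simp add: power2_eq_square mult_ac)
    also have "\<dots> < 2 * (1 + lam)\<^sup>2 / (1 - lam)\<^sup>2 * 1"
      using lam by (intro mult_strict_left_mono) (auto simp: a_def)
    finally show ?thesis by simp
  qed
  have strict: "2 * (1 + lam)\<^sup>2 * (1 - lam ^ (n - 1)) / (1 - lam)\<^sup>2 < 2 * (1 + lam)\<^sup>2 / (1 - lam)\<^sup>2"
    using lam by (intro divide_strict_right_mono) auto
  have "numerical_radius (complex_mat (mat 1 :: real^'n^'n)) = 1"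
    by (rule numerical_radius_one)
  then show ?thesis
    using inv cond upper last strict numerical_radius_le_spectral_norm[of "Q ** matrix_inv Q"]
      spectral_norm_mult_le[of Q "matrix_inv Q"]
    by (simp add: cond_number_def)
qed

end
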